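(* Let $w$ be the Arshon sequence over the alphabet $\{1,2,3\}$. There does not exist a morphism $\varphi:\{1,2,3\}^{\star}\to\{1,2,3\}^{\star}$ having $w$ as a fixed point; that is, there is no morphism $\varphi$ and letter $a\in\{1,2,3\}$ such that $\varphi(a)$ begins with $a$, the lengths $|\varphi^k(a)|$ increase without bound, and $\lim_{k\to\infty}\varphi^k(a)=w$.
   Context: The Arshon sequence is defined as follows. Let $w_1=1$. For $k\ge 1$, the word $w_{k+1}$ is obtained from $w_k$ by replacing each letter in an odd position (positions counted from $1$) according to $1\mapsto 123$, $2\mapsto 231$, $3\mapsto 312$, and each letter in an even position according to $1\mapsto 321$, $2\mapsto 132$, $3\mapsto 213$. Thus $w_2=123$, $w_3=123132312$, and each $w_k$ is a prefix of $w_{k+1}$; the Arshon sequence is the infinite sequence $w=\lim_{k\to\infty}w_k$. A morphism $\varphi$ on $\Sigma^{\star}$ (the set of finite words over $\Sigma$) is a map with $\varphi(uv)=\varphi(u)\varphi(v)$ for all words $u,v$. If $\varphi(a)$ begins with $a$ and $|\varphi^k(a)|$ increases without bound, then each $\varphi^k(a)$ is a prefix of $\varphi^{k+1}(a)$ and the infinite sequence $\lim_{k\to\infty}\varphi^k(a)$ is called a fixed point of $\varphi$. *)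

theory Defs
  imports Complex_Main "HOL-Library.Sublist"
begin

datatype letter = L1 | L2 | L3

definition morphism :: "('a list \<Rightarrow> 'b list) \<Rightarrow> bool" where
  "morphism f \<longleftrightarrow> (\<forall>u v. f (u @ v) = f u @ f v)"

(* An infinite sequence is a function on nat, with x n its (n+1)-st letter.  The limit of
   a sequence of finite words is letterwise: every position is eventually defined and stable. *)
definition word_limit :: "(nat \<Rightarrow> 'a list) \<Rightarrow> (nat \<Rightarrow> 'a) \<Rightarrow> bool" where
  "word_limit u x \<longleftrightarrow> (\<forall>n. \<forall>\<^sub>F k in sequentially. n < length (u k) \<and> u k ! n = x n)"

definition fixed_point_from :: "('a list \<Rightarrow> 'a list) \<Rightarrow> 'a \<Rightarrow> (nat \<Rightarrow> 'a) \<Rightarrow> bool" where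
  "fixed_point_from f a x \<longleftrightarrow>
     prefix [a] (f [a]) \<and>
     filterlim (\<lambda>k. length ((f ^^ k) [a])) at_top sequentially \<and>
     word_limit (\<lambda>k. (f ^^ k) [a]) x"

fun odd_block :: "letter \<Rightarrow> letter list" where
  "odd_block L1 = [L1, L2, L3]"
| "odd_block L2 = [L2, L3, L1]"
| "odd_block L3 = [L3, L1, L2]"

fun even_block :: "letter \<Rightarrow> letter list" where
  "even_block L1 = [L3, L2, L1]"
| "even_block L2 = [L1, L3, L2]"
| "even_block L3 = [L2, L1, L3]"

(* The letter w ! i stands in position Suc i, positions being counted from 1. *)
definition arshon_step :: "letter list \<Rightarrow> letter list" where
  "arshon_step w =
     concat (map (\<lambda>i. if odd (Suc i) then odd_block (w ! i) else even_block (w ! i))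
                 [0..<length w])"

(* arshon_word k is the word w_(k+1). *)
primrec arshon_word :: "nat \<Rightarrow> letter list" where
  "arshon_word 0 = [L1]"
| "arshon_word (Suc k) = arshon_step (arshon_word k)"

definition arshon :: "nat \<Rightarrow> letter" where
  "arshon = (THE x. word_limit arshon_word x)"

lemma arshon_word_1: "arshon_word (Suc 0) = [L1, L2, L3]"
  and arshon_word_2: "arshon_word (Suc (Suc 0)) = [L1, L2, L3, L1, L3, L2, L3, L1, L2]"
  by (simp_all add: arshon_step_def upt_rec)

lemma word_limit_unique:
  assumes "word_limit u x" "word_limit u y"
  shows "x = y"
proof
  fix n
  have "\<forall>\<^sub>F k in sequentially. x n = y n"
    using assms[unfolded word_limit_def, rule_format, of n]
    by eventually_elim simp
  then show "x n = y n" by simp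
qed

lemma length_arshon_step: "length (arshon_step w) = 3 * length w"
proof -
  have odd: "length (odd_block c) = 3" and even: "length (even_block c) = 3" for c
    by (cases c; simp)+
  have "length (if odd (Suc i) then odd_block (w ! i) else even_block (w ! i)) = 3" for i
    by (simp add: odd even)
  then show ?thesis
    unfolding arshon_step_def length_concat map_map comp_def
    by (simp only: sum_list_triv map_replicate_const) (simp add: sum_list_replicate)
qed

lemma arshon_step_prefix:
  assumes "prefix u v"
  shows "prefix (arshon_step u) (arshon_step v)"
proof -
  obtain t where v: "v = u @ t" using assms by (auto simp: prefix_def)
  let ?g = "\<lambda>w i. if odd (Suc i) then odd_block (w ! i) else even_block (w ! i)"
  have "[0..<length v] = [0..<length u] @ [length u..<length v]"
    using upt_add_eq_append[of 0 "length u" "length t"] by (simp add: v)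
  moreover have "map (?g v) [0..<length u] = map (?g u) [0..<length u]"
    by (rule map_cong) (auto simp: v nth_append)
  ultimately show ?thesis
    unfolding arshon_step_def by (simp only: map_append concat_append prefixI)
qed

lemma length_arshon_word: "length (arshon_word k) = 3 ^ k"
  by (induction k) (simp_all add: length_arshon_step)

lemma arshon_word_prefix_Suc: "prefix (arshon_word k) (arshon_word (Suc k))"
proof (induction k)
  case 0
  then show ?case by (simp add: arshon_step_def)
next
  case (Suc k)
  then show ?case using arshon_step_prefix by simp
qed

lemma arshon_word_prefix: "k \<le> m \<Longrightarrow> prefix (arshon_word k) (arshon_word m)"
  by (induction rule: dec_induct)
     (use arshon_word_prefix_Suc prefix_order.trans in blast)+

lemma word_limit_arshon: "word_limit arshon_word arshon"
proof -
  have "word_limit arshon_word (\<lambda>n. arshon_word n ! n)"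
    unfolding word_limit_def
  proof
    fix n
    have n: "n < length (arshon_word n)"
      by (simp add: length_arshon_word power_gt_expt)
    show "\<forall>\<^sub>F k in sequentially.
            n < length (arshon_word k) \<and> arshon_word k ! n = arshon_word n ! n"
      using eventually_ge_at_top[of n]
    proof eventually_elim
      case (elim k)
      from arshon_word_prefix[OF this] obtain t where "arshon_word k = arshon_word n @ t"
        by (auto simp: prefix_def)
      then show ?case using n by (simp add: nth_append)
    qed
  qed
  then show ?thesis
    unfolding arshon_def
    by (blast intro: theI[of "word_limit arshon_word"] word_limit_unique)
qed

end

theory Submission
  imports Defs
begin

text \<open>
  Let \<open>w\<close> be the Arshon sequence. A morphism fixing \<open>w\<close> is determined by its three image lengths
  \<open>l\<close>: equal letters of \<open>w\<close> must have equal images when \<open>w\<close> is cut into consecutive factors of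
  lengths \<open>l (w 0), l (w 1), \<dots>\<close>. The pattern of ascents of \<open>w\<close> is the Toeplitz sequence
  \<open>+ + ? - - ?\<close>, any 8 consecutive terms of which determine the position modulo 6. So if some
  image has length at least 9, then all occurrences of that image lie at positions in one class
  modulo 6, which forces all three lengths to be multiples of 6; the blocks of \<open>w\<close> having length 3,
  the lengths \<open>l / 3\<close> are then admissible as well. This descent, along which the image of 1 keeps
  length at least 2, ends with lengths below 9, and these are excluded by inspecting a prefix of
  \<open>w\<close>.
\<close>

section \<open>The Arshon sequence as a Toeplitz sequence\<close>

fun nxt :: "letter \<Rightarrow> letter" where
  "nxt L1 = L2"
| "nxt L2 = L3"
| "nxt L3 = L1"

lemma nxt_inject [simp]: "nxt x = nxt y \<longleftrightarrow> x = y"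
  by (cases x; cases y; simp)

lemma nxt_nxt_nxt [simp]: "nxt (nxt (nxt x)) = x"
  by (cases x; simp)

lemma nxt_nxt_eq_iff: "nxt (nxt x) = y \<longleftrightarrow> x = nxt y"
  by (cases x; cases y; simp)

lemma nxt_nxt_neq [simp]: "nxt (nxt x) \<noteq> x" "x \<noteq> nxt (nxt x)" "nxt x \<noteq> x" "x \<noteq> nxt x"
  by (cases x; simp)+

lemma odd_block_conv: "odd_block x = [x, nxt x, nxt (nxt x)]"
  by (cases x; simp)

lemma even_block_conv: "even_block x = [nxt (nxt x), nxt x, x]"
  by (cases x; simp)

lemma nth_concat_blocks3:
  assumes "\<And>x. x \<in> set xs \<Longrightarrow> length (g x) = 3" "i < length xs" "j < 3"
  shows "concat (map g xs) ! (3 * i + j) = g (xs ! i) ! j"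
  using assms
proof (induction xs arbitrary: i)
  case Nil
  then show ?case by simp
next
  case (Cons x xs)
  then show ?case
    by (cases i) (simp_all add: nth_append)
qed

lemma arshon_step_nth:
  assumes "i < length u" "j < 3"
  shows "arshon_step u ! (3 * i + j)
    = (if even i then odd_block (u ! i) else even_block (u ! i)) ! j"
  unfolding arshon_step_def using assms
  by (subst nth_concat_blocks3) (auto simp: odd_block_conv even_block_conv)

lemma arshon_nth:
  assumes "n < 3 ^ k"
  shows "arshon n = arshon_word k ! n"
proof -
  have "\<forall>\<^sub>F m in sequentially. n < length (arshon_word m) \<and> arshon_word m ! n = arshon n"
    using word_limit_arshon by (simp add: word_limit_def)
  then have "\<forall>\<^sub>F m in sequentially. arshon n = arshon_word k ! n"
    using eventually_ge_at_top[of k]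
  proof eventually_elim
    case (elim m)
    from arshon_word_prefix[OF elim(2)] obtain t where "arshon_word m = arshon_word k @ t"
      by (auto simp: prefix_def)
    with elim(1) assms show ?case
      by (simp add: nth_append length_arshon_word)
  qed
  then show ?thesis by simp
qed

lemma arshon_block:
  assumes "j < 3"
  shows "arshon (3 * n + j)
    = (if even n then odd_block (arshon n) else even_block (arshon n)) ! j"
proof -
  have n: "n < 3 ^ n" by (simp add: power_gt_expt)
  then have "3 * n + j < 3 ^ Suc n"
    using assms by simp
  then have "arshon (3 * n + j) = arshon_step (arshon_word n) ! (3 * n + j)"
    using arshon_nth[of "3 * n + j" "Suc n"] by simp
  also have "\<dots> = (if even n then odd_block (arshon n) else even_block (arshon n)) ! j"
    using n assms by (simp add: arshon_step_nth length_arshon_word arshon_nth[of n n])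
  finally show ?thesis .
qed

lemma arshon_3n: "arshon (3 * n) = (if even n then arshon n else nxt (nxt (arshon n)))"
  using arshon_block[of 0 n] by (simp add: odd_block_conv even_block_conv)

text \<open>Both kinds of block have the same middle letter, so it reveals \<open>arshon n\<close>
  whatever the parity of \<open>n\<close>. The descent relies on this.\<close>

lemma arshon_3n1: "arshon (3 * n + 1) = nxt (arshon n)"
  using arshon_block[of 1 n] by (simp add: odd_block_conv even_block_conv)

lemma arshon_3n2: "arshon (3 * n + 2) = (if even n then nxt (nxt (arshon n)) else arshon n)"
  using arshon_block[of 2 n] by (simp add: odd_block_conv even_block_conv)

section \<open>Ascents and recognition of positions modulo 6\<close>

definition ascent :: "nat \<Rightarrow> bool" where
  "ascent n \<longleftrightarrow> arshon (Suc n) = nxt (arshon n)"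

lemma ascent_3n: "ascent (3 * n) \<longleftrightarrow> even n"
  using arshon_3n[of n] arshon_3n1[of n] by (auto simp: ascent_def)

lemma ascent_3n1: "ascent (3 * n + 1) \<longleftrightarrow> even n"
  using arshon_3n1[of n] arshon_3n2[of n] by (auto simp: ascent_def)

text \<open>Adjacent blocks are of opposite kinds, so the two letters meeting at their boundary are
  \<open>arshon n\<close> and \<open>arshon (Suc n)\<close>, either both unchanged or both rotated
  twice by \<open>nxt\<close>.\<close>

lemma ascent_3n2: "ascent (3 * n + 2) \<longleftrightarrow> ascent n"
proof -
  have "Suc (3 * n + 2) = 3 * Suc n" by simp
  then show ?thesis
    using arshon_3n2[of n] arshon_3n[of "Suc n"] by (auto simp: ascent_def nxt_nxt_eq_iff simp del: mult_Suc_right)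
qed

text \<open>Two rounds of the Toeplitz substitution, leaving the positions 8 modulo 9 undetermined.\<close>
definition toeplitz :: "nat \<Rightarrow> bool option" where
  "toeplitz n =
     (if n mod 3 \<noteq> 2 then Some (n mod 6 < 3)
      else if n mod 9 \<noteq> 8 then Some (n mod 18 < 9) else None)"

lemma ascent_not_2_mod_3:
  assumes "n mod 3 \<noteq> 2"
  shows "ascent n \<longleftrightarrow> n mod 6 < 3"
proof -
  have "n = 3 * (n div 3) \<or> n = 3 * (n div 3) + 1" using assms by presburger
  then consider "n = 3 * (n div 3)" | "n = 3 * (n div 3) + 1" by blast
  then show ?thesis
  proof cases
    case 1
    with ascent_3n[of "n div 3"] have "ascent n \<longleftrightarrow> even (n div 3)" by simp
    then show ?thesis by presburger
  next
    case 2
    with ascent_3n1[of "n div 3"] have "ascent n \<longleftrightarrow> even (n div 3)" by simp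
    then show ?thesis by presburger
  qed
qed

lemma toeplitz_SomeD:
  assumes "toeplitz n = Some b"
  shows "ascent n = b"
proof (cases "n mod 3 = 2")
  case False
  with assms show ?thesis by (simp add: toeplitz_def ascent_not_2_mod_3)
next
  case True
  define m where "m = n div 3"
  have n: "n = 3 * m + 2" using True unfolding m_def by presburger
  have "n mod 9 \<noteq> 8" "b \<longleftrightarrow> n mod 18 < 9"
    using assms True by (auto simp: toeplitz_def split: if_splits)
  moreover from this have "m mod 3 \<noteq> 2" unfolding n by presburger
  moreover have "n mod 18 < 9 \<longleftrightarrow> m mod 6 < 3" unfolding n by presburger
  ultimately show ?thesis
    using ascent_3n2[of m] ascent_not_2_mod_3[of m] n by simp
qed

lemma toeplitz_mod_18: "toeplitz (n mod 18 + i) = toeplitz (n + i)"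
proof -
  have "(n mod 18 + i) mod d = (n + i) mod d" if "d dvd 18" for d
    by (metis mod_add_left_eq mod_mod_cancel that)
  from this[of 3] this[of 6] this[of 9] this[of 18] show ?thesis
    by (simp add: toeplitz_def)
qed

text \<open>Period 18 makes this a finite check. Demanding a value on both sides ensures that actual
  ascents disagree, not a known position with an undetermined one.\<close>

lemma toeplitz_separates:
  "\<forall>r \<in> set [0..<18]. \<forall>s \<in> set [0..<18]. r mod 6 \<noteq> s mod 6 \<longrightarrow>
     (\<exists>i \<in> set [0..<8]. toeplitz (r + i) \<noteq> None \<and> toeplitz (s + i) \<noteq> None \<and>
        toeplitz (r + i) \<noteq> toeplitz (s + i))"
  by code_simp

text \<open>Nine equal letters give eight equal ascents, the window searched in
  \<open>toeplitz_separates\<close>.\<close>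

lemma mod_6_eq_if_factor_eq:
  assumes eq: "\<And>i. i < 9 \<Longrightarrow> arshon (p + i) = arshon (q + i)"
  shows "p mod 6 = q mod 6"
proof (rule ccontr)
  assume "p mod 6 \<noteq> q mod 6"
  then have "(p mod 18) mod 6 \<noteq> (q mod 18) mod 6" by (simp add: mod_mod_cancel)
  then obtain i where i: "i < 8" "toeplitz (p mod 18 + i) \<noteq> None" "toeplitz (q mod 18 + i) \<noteq> None"
    "toeplitz (p mod 18 + i) \<noteq> toeplitz (q mod 18 + i)"
    using toeplitz_separates[rule_format, of "p mod 18" "q mod 18"] by auto
  then obtain b c where "toeplitz (p + i) = Some b" "toeplitz (q + i) = Some c" "b \<noteq> c"
    unfolding toeplitz_mod_18 by auto
  then have "ascent (p + i) \<noteq> ascent (q + i)" by (auto dest: toeplitz_SomeD)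
  with eq[of i] eq[of "Suc i"] i(1) show False by (simp add: ascent_def)
qed

section \<open>Admissible image lengths\<close>

text \<open>The start of the image of the letter at position \<open>n\<close> when all images are
  laid end to end.\<close>

definition offset :: "(letter \<Rightarrow> nat) \<Rightarrow> nat \<Rightarrow> nat" where
  "offset l n = (\<Sum>i<n. l (arshon i))"

definition admissible :: "(letter \<Rightarrow> nat) \<Rightarrow> bool" where
  "admissible l \<longleftrightarrow> (\<forall>m n j. arshon m = arshon n \<longrightarrow> j < l (arshon n) \<longrightarrow>
     arshon (offset l m + j) = arshon (offset l n + j))"

lemma admissibleD:
  assumes "admissible l" "arshon m = arshon n" "j < l (arshon n)"
  shows "arshon (offset l m + j) = arshon (offset l n + j)"
  using assms unfolding admissible_def by blast

text \<open>With lengths at most 8 the final finite check reads indices up to 47, beyond the 27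
  letters of \<open>arshon_word 3\<close>.\<close>

lemma arshon_word_4:
  "arshon_word 4 =
    [L1, L2, L3, L1, L3, L2, L3, L1, L2, L3, L2, L1, L3, L1, L2, L1, L3, L2, L3, L1, L2, L3,
     L2, L1, L2, L3, L1, L2, L1, L3, L2, L3, L1, L3, L2, L1, L3, L1, L2, L3, L2, L1, L2, L3,
     L1, L3, L2, L1, L3, L1, L2, L1, L3, L2, L3, L1, L2, L3, L2, L1, L2, L3, L1, L2, L1, L3,
     L2, L3, L1, L3, L2, L1, L2, L3, L1, L2, L1, L3, L1, L2, L3]"
  by code_simp

lemma arshon_initial:
  "arshon 0 = L1" "arshon (Suc 0) = L2" "arshon 2 = L3" "arshon 3 = L1" "arshon 4 = L3"
  "arshon 5 = L2" "arshon 6 = L3" "arshon 7 = L1" "arshon 8 = L2" "arshon 9 = L3" "arshon 10 = L2"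
  "arshon 11 = L1"
  by (simp_all add: arshon_nth[where k = 4] arshon_word_4)

lemma offset_0: "offset l 0 = 0"
  by (simp add: offset_def)

lemma offset_Suc: "offset l (Suc n) = offset l n + l (arshon n)"
  by (simp add: offset_def)

lemma offset_numeral:
  "offset l (numeral k) = offset l (pred_numeral k) + l (arshon (pred_numeral k))"
  by (simp add: numeral_eq_Suc offset_Suc)

lemma offset_initial:
  "offset l 0 = 0" "offset l (Suc 0) = l L1" "offset l 2 = l L1 + l L2"
  "offset l 3 = l L1 + l L2 + l L3" "offset l 4 = 2 * l L1 + l L2 + l L3"
  "offset l 5 = 2 * l L1 + l L2 + 2 * l L3" "offset l 6 = 2 * l L1 + 2 * l L2 + 2 * l L3"
  "offset l 7 = 2 * l L1 + 2 * l L2 + 3 * l L3" "offset l 8 = 3 * l L1 + 2 * l L2 + 3 * l L3"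
  "offset l 9 = 3 * l L1 + 3 * l L2 + 3 * l L3" "offset l 10 = 3 * l L1 + 3 * l L2 + 4 * l L3"
  "offset l 11 = 3 * l L1 + 4 * l L2 + 4 * l L3"
  by (simp_all add: offset_0 offset_Suc offset_numeral arshon_initial)

text \<open>All images of \<open>c\<close> start in one class modulo 6, so the distance between any
  two of them is a multiple of 6. Occurrences of \<open>c\<close> among the first twelve letters
  yield each single length by subtraction.\<close>

lemma dvd_6_if_long:
  assumes l: "admissible l" and "9 \<le> l c"
  shows "6 dvd l x"
proof -
  have gap: "6 dvd d" if "arshon m = c" "arshon n = c" "offset l n = offset l m + d" for m n d
  proof -
    have "(offset l m + d) mod 6 = (offset l m + 0) mod 6"
      using admissibleD[OF l, of n m] that assms(2) by (intro mod_6_eq_if_factor_eq) auto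
    then show ?thesis
      by presburger
  qed
  have "6 dvd l L1 \<and> 6 dvd l L2 \<and> 6 dvd l L3"
  proof (cases c)
    case L1
    have s: "6 dvd l L1 + l L2 + l L3"
      by (rule gap[of 0 3]) (simp_all add: L1 arshon_initial offset_initial)
    have "6 dvd (l L1 + l L2 + l L3) + l L3"
      by (rule gap[of 3 7]) (simp_all add: L1 arshon_initial offset_initial)
    moreover have "6 dvd (l L1 + l L2 + l L3) + l L2"
      by (rule gap[of 7 11]) (simp_all add: L1 arshon_initial offset_initial)
    ultimately show ?thesis
      using s by (metis dvd_add_left_iff dvd_add_right_iff)
  next
    case L2
    have s: "6 dvd l L2 + l L3"
      by (rule gap[of 8 10]) (simp_all add: L2 arshon_initial offset_initial)
    have "6 dvd l L1 + (l L2 + l L3)"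
      by (rule gap[of 5 8]) (simp_all add: L2 arshon_initial offset_initial)
    moreover have "6 dvd (l L1 + (l L2 + l L3)) + l L3"
      by (rule gap[of 1 5]) (simp_all add: L2 arshon_initial offset_initial)
    ultimately show ?thesis
      using s by (metis dvd_add_left_iff dvd_add_right_iff)
  next
    case L3
    have s: "6 dvd l L1 + l L3"
      by (rule gap[of 2 4]) (simp_all add: L3 arshon_initial offset_initial)
    have "6 dvd l L2 + l L3"
      by (rule gap[of 4 6]) (simp_all add: L3 arshon_initial offset_initial)
    moreover have "6 dvd (l L1 + l L3) + l L2"
      by (rule gap[of 6 9]) (simp_all add: L3 arshon_initial offset_initial)
    ultimately show ?thesis
      using s by (metis dvd_add_left_iff dvd_add_right_iff)
  qed
  then show ?thesis by (cases x) auto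
qed

text \<open>Divisibility by 3 aligns the image starts with block starts; the middle letters of the
  blocks then transfer the condition to a third of the lengths.\<close>

lemma admissible_div_3:
  assumes l: "admissible l" and six: "\<And>x. 6 dvd l x"
  shows "admissible (\<lambda>x. l x div 3)"
proof -
  have l3: "3 * (l x div 3) = l x" for x
    using six[of x] by presburger
  have off: "3 * offset (\<lambda>x. l x div 3) n = offset l n" for n
    by (simp add: offset_def sum_distrib_left l3)
  show ?thesis
    unfolding admissible_def
  proof (intro allI impI)
    fix m n j
    assume "arshon m = arshon n" "j < l (arshon n) div 3"
    moreover from this have "3 * j + 1 < l (arshon n)" by linarith
    ultimately have "arshon (offset l m + (3 * j + 1)) = arshon (offset l n + (3 * j + 1))"
      using l by (blast intro: admissibleD)
    then have "arshon (3 * (offset (\<lambda>x. l x div 3) m + j) + 1)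
        = arshon (3 * (offset (\<lambda>x. l x div 3) n + j) + 1)"
      by (simp add: off[symmetric] algebra_simps)
    then show "arshon (offset (\<lambda>x. l x div 3) m + j) = arshon (offset (\<lambda>x. l x div 3) n + j)"
      unfolding arshon_3n1 by simp
  qed
qed

text \<open>The lengths for 1, 2, 3 are \<open>a\<close>, \<open>b\<close>, \<open>c\<close>. The
  second occurrences of 1, 3, 2 (positions 3, 4, 5) are compared with the first (0, 2, 1). Starting
  \<open>a\<close> at 2 leaves out the identity; \<open>b\<close> and \<open>c\<close> may be 0, as
  letters may be erased.\<close>

lemma no_short_lengths:
  "\<forall>a \<in> set [2..<9]. \<forall>b \<in> set [0..<9]. \<forall>c \<in> set [0..<9].
     \<not> ((\<forall>j \<in> set [0..<a]. arshon_word 4 ! (a + b + c + j) = arshon_word 4 ! j) \<and>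
        (\<forall>j \<in> set [0..<c]. arshon_word 4 ! (2 * a + b + c + j) = arshon_word 4 ! (a + b + j)) \<and>
        (\<forall>j \<in> set [0..<b]. arshon_word 4 ! (2 * a + b + 2 * c + j) = arshon_word 4 ! (a + j)))"
  unfolding arshon_word_4 by code_simp

lemma not_admissible:
  assumes "2 \<le> l L1"
  shows "\<not> admissible l"
  using assms
proof (induction "l L1" arbitrary: l rule: less_induct)
  case less
  show ?case
  proof
    assume adm: "admissible l"
    show False
    proof (cases "\<exists>c. 9 \<le> l c")
      case True
      then have six: "6 dvd l x" for x
        using dvd_6_if_long[OF adm] by blast
      \<comment> \<open>A positive multiple of 6; hence a third of it is still at least 2.\<close>
      have "6 \<le> l L1"
        using six[of L1] less.prems by (auto elim: dvdE)
      then have "l L1 div 3 < l L1" "2 \<le> l L1 div 3" by linarith+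
      with less.hyps[of "\<lambda>x. l x div 3"] admissible_div_3[OF adm six] show False by blast
    next
      case False
      then have short: "l x < 9" for x by (auto simp: not_le)
      let ?a = "l L1" and ?b = "l L2" and ?c = "l L3"
      have bounds: "?a < 9" "?b < 9" "?c < 9" by (rule short)+
      have nth: "arshon_word 4 ! n = arshon n" if "n < 81" for n
        using that arshon_nth[of n 4] by simp
      have "arshon_word 4 ! (?a + ?b + ?c + j) = arshon_word 4 ! j" if "j < ?a" for j
        using admissibleD[OF adm, of 3 0 j] that bounds
        by (simp add: arshon_initial offset_initial nth)
      moreover have "arshon_word 4 ! (2 * ?a + ?b + ?c + j) = arshon_word 4 ! (?a + ?b + j)"
        if "j < ?c" for j
        using admissibleD[OF adm, of 4 2 j] that bounds
        by (simp add: arshon_initial offset_initial nth)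
      moreover have "arshon_word 4 ! (2 * ?a + ?b + 2 * ?c + j) = arshon_word 4 ! (?a + j)"
        if "j < ?b" for j
        using admissibleD[OF adm, of 5 1 j] that bounds
        by (simp add: arshon_initial offset_initial nth)
      moreover have "?a \<in> set [2..<9]" "?b \<in> set [0..<9]" "?c \<in> set [0..<9]"
        unfolding set_upt atLeastLessThan_iff using bounds less.prems by simp_all
      ultimately show False
        using no_short_lengths by (metis atLeastLessThan_iff set_upt)
    qed
  qed
qed

section \<open>Morphisms fixing the Arshon sequence\<close>

lemma morphism_Nil:
  assumes "morphism f"
  shows "f [] = []"
  using assms[unfolded morphism_def, rule_format, of "[]" "[]"] by simp

lemma morphism_prefix:
  assumes "morphism f" "prefix u v"
  shows "prefix (f u) (f v)"
  using assms by (auto simp: morphism_def prefix_def)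

definition arshon_prefix :: "nat \<Rightarrow> letter list" where
  "arshon_prefix n = map arshon [0..<n]"

lemma length_arshon_prefix [simp]: "length (arshon_prefix n) = n"
  by (simp add: arshon_prefix_def)

lemma arshon_prefix_nth [simp]: "i < n \<Longrightarrow> arshon_prefix n ! i = arshon i"
  by (simp add: arshon_prefix_def)

lemma arshon_prefix_Suc: "arshon_prefix (Suc n) = arshon_prefix n @ [arshon n]"
  by (simp add: arshon_prefix_def)

lemma eventually_arshon_prefix:
  assumes "word_limit u arshon"
  shows "\<forall>\<^sub>F k in sequentially. prefix (arshon_prefix n) (u k)"
proof -
  \<comment> \<open>Including position \<open>n\<close> forces \<open>u k\<close> to be longer than
    \<open>n\<close>, so \<open>take n\<close> is not cut short.\<close>
  have "\<forall>\<^sub>F k in sequentially. \<forall>i \<in> {..<Suc n}. i < length (u k) \<and> u k ! i = arshon i"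
    using assms by (intro eventually_ball_finite) (auto simp: word_limit_def)
  then show ?thesis
  proof eventually_elim
    case (elim k)
    then have "arshon_prefix n = take n (u k)"
      by (intro nth_equalityI) auto
    then show ?case by (metis take_is_prefix)
  qed
qed

text \<open>A late iterate extends \<open>arshon_prefix n\<close>, so the next one extends both
  \<open>f (arshon_prefix n)\<close> and the prefix of \<open>arshon\<close> of that length; the two
  coincide.\<close>

lemma morphism_arshon_prefix:
  assumes f: "morphism f" and lim: "word_limit (\<lambda>k. (f ^^ k) [a]) arshon"
  shows "f (arshon_prefix n) = arshon_prefix (length (f (arshon_prefix n)))"
proof -
  let ?m = "length (f (arshon_prefix n))"
  have "\<forall>\<^sub>F k in sequentially. prefix (arshon_prefix ?m) ((f ^^ Suc k) [a])"
    using eventually_arshon_prefix[OF lim] by (rule eventually_sequentially_Suc[THEN iffD2])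
  with eventually_arshon_prefix[OF lim, of n]
  have "\<forall>\<^sub>F k in sequentially. f (arshon_prefix n) = arshon_prefix ?m"
  proof eventually_elim
    case (elim k)
    then have "prefix (f (arshon_prefix n)) ((f ^^ Suc k) [a])"
      using morphism_prefix[OF f] by simp
    with elim(2) show ?case
      by (metis length_arshon_prefix prefix_length_prefix prefix_order.antisym order_refl)
  qed
  then show ?thesis by simp
qed

text \<open>Passing from \<open>n\<close> to \<open>Suc n\<close> appends
  \<open>f [arshon n]\<close>, so the factor starting at the offset depends on the letter
  alone.\<close>

lemma admissible_of_morphism:
  assumes f: "morphism f" 
    and pre: "\<And>n. f (arshon_prefix n) = arshon_prefix (length (f (arshon_prefix n)))"
  shows "admissible (\<lambda>x. length (f [x]))"
proof -
  let ?l = "\<lambda>x. length (f [x])"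
  have len: "length (f (arshon_prefix n)) = offset ?l n" for n
    using f by (induction n)
      (simp_all add: arshon_prefix_Suc morphism_def offset_def morphism_Nil[OF f],
       simp add: arshon_prefix_def morphism_Nil[OF f])
  have "arshon (offset ?l n + j) = f [arshon n] ! j" if "j < ?l (arshon n)" for n j
  proof -
    have eq: "f (arshon_prefix (Suc n)) = arshon_prefix (offset ?l n) @ f [arshon n]"
      using f pre[of n] by (simp add: arshon_prefix_Suc morphism_def len)
    have "offset ?l n + j < offset ?l (Suc n)"
      using that by (simp add: offset_def)
    then have "arshon (offset ?l n + j) = f (arshon_prefix (Suc n)) ! (offset ?l n + j)"
      using pre[of "Suc n"] by (simp add: len)
    also have "\<dots> = f [arshon n] ! j"
      by (simp add: eq nth_append)
    finally show ?thesis .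
  qed
  then show ?thesis unfolding admissible_def by simp
qed

theorem theorem1:
  shows "\<not> (\<exists>(\<phi> :: letter list \<Rightarrow> letter list) (a :: letter).
            morphism \<phi> \<and> fixed_point_from \<phi> a arshon)"
proof
  assume "\<exists>(\<phi> :: letter list \<Rightarrow> letter list) (a :: letter).
            morphism \<phi> \<and> fixed_point_from \<phi> a arshon"
  then obtain \<phi> :: "letter list \<Rightarrow> letter list" and a where \<phi>: "morphism \<phi>"
    and start: "prefix [a] (\<phi> [a])"
    and grow: "filterlim (\<lambda>k. length ((\<phi> ^^ k) [a])) at_top sequentially"
    and lim: "word_limit (\<lambda>k. (\<phi> ^^ k) [a]) arshon"
    unfolding fixed_point_from_def by blast
  have pre: "prefix [a] ((\<phi> ^^ k) [a])" for k
  proof (induction k)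
    case 0
    then show ?case by simp
  next
    case (Suc k)
    from start morphism_prefix[OF \<phi> this] show ?case
      by (auto intro: prefix_order.trans)
  qed
  \<comment> \<open>Every iterate begins with \<open>a\<close>, and the limit begins with 1.\<close>
  have "\<forall>\<^sub>F k in sequentially. a = L1"
    using lim[unfolded word_limit_def, rule_format, of 0]
  proof eventually_elim
    case (elim k)
    with pre[of k] show ?case by (auto simp: prefix_def arshon_initial)
  qed
  then have a: "a = L1" by simp
  \<comment> \<open>Otherwise the image of \<open>a\<close> is \<open>[a]\<close>, and the iterates
    do not grow.\<close>
  have "2 \<le> length (\<phi> [L1])"
  proof (rule ccontr)
    assume "\<not> 2 \<le> length (\<phi> [L1])"
    with start have "\<phi> [a] = [a]" by (auto simp: prefix_def a Suc_le_eq)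
    then have "(\<phi> ^^ k) [a] = [a]" for k by (induction k) simp_all
    with grow show False
      by (simp add: filterlim_at_top) (metis not_less_eq_eq zero_less_one_class.zero_le_one)
  qed
  then show False
    using not_admissible[of "\<lambda>x. length (\<phi> [x])"]
      admissible_of_morphism[OF \<phi> morphism_arshon_prefix[OF \<phi> lim]] by blast
qed

end
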